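(* Let $\alpha\in[0,1]$. If $T\in\mathbb{B}_A(\mathcal{H})$, then $$\omega_{\|\cdot\|_{A,\alpha}}(T)=\omega_A(T).$$
   Context: $\mathcal{H}$ is a complex Hilbert space with inner product $\langle\cdot,\cdot\rangle$, $\mathbb{B}(\mathcal{H})$ is the algebra of bounded linear operators on $\mathcal{H}$, and $A\in\mathbb{B}(\mathcal{H})$ is a non-zero positive operator ($\langle Ax,x\rangle\ge 0$ for all $x$). Put $\langle x,y\rangle_A=\langle Ax,y\rangle$ and $\|x\|_A=\sqrt{\langle Ax,x\rangle}$. $\mathbb{B}_A(\mathcal{H})$ is the set of $T\in\mathbb{B}(\mathcal{H})$ with $\mathcal{R}(T^*A)\subseteq\mathcal{R}(A)$ ($\mathcal{R}$ denotes range). $\mathbb{B}_{A^{1/2}}(\mathcal{H})$ is the set of $T\in\mathbb{B}(\mathcal{H})$ for which there is $c>0$ with $\|Tx\|_A\le c\|x\|_A$ for all $x\in\mathcal{H}$; $\mathbb{B}_A(\mathcal{H})\subseteq\mathbb{B}_{A^{1/2}}(\mathcal{H})$. For $T\in\mathbb{B}_A(\mathcal{H})$, $T^{\sharp_A}$ is the unique $X\in\mathbb{B}(\mathcal{H})$ with $AX=T^*A$ and $\mathcal{R}(X)\subseteq\overline{\mathcal{R}(A)}$. Put $\Re_A(T)=\frac{T+T^{\sharp_A}}{2}$. The $A$-numerical radius is $\omega_A(T)=\sup\{|\langle Tx,x\rangle_A|: x\in\mathcal{H},\ \|x\|_A=1\}$. For $T\in\mathbb{B}_{A^{1/2}}(\mathcal{H})$,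 $$\|T\|_{A,\alpha}=\sup_{\|x\|_A=1}\sqrt{\alpha|\langle Tx,x\rangle_A|^2+(1-\alpha)\|Tx\|_A^2},$$ and for $T\in\mathbb{B}_A(\mathcal{H})$, $\omega_{\|\cdot\|_{A,\alpha}}(T)=\sup_{\theta\in\mathbb{R}}\|\Re_A(e^{i\theta}T)\|_{A,\alpha}$. *)

theory Defs
  imports "HOL-Analysis.Analysis"
begin

text \<open>
  A complex Hilbert space is presented on top of the library's real inner product spaces: the
  underlying real space carries the norm and topology, and its inner product is the real part
  of the complex one. The complex inner product is linear in the first argument.
\<close>

class complex_vector = real_vector +
  fixes scaleC :: "complex \<Rightarrow> 'a \<Rightarrow> 'a" (infixr "*\<^sub>C" 75)
  assumes scaleC_add_right: "a *\<^sub>C (x + y) = a *\<^sub>C x + a *\<^sub>C y"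
    and scaleC_add_left: "(a + b) *\<^sub>C x = a *\<^sub>C x + b *\<^sub>C x"
    and scaleC_scaleC: "a *\<^sub>C (b *\<^sub>C x) = (a * b) *\<^sub>C x"
    and scaleC_of_real: "complex_of_real r *\<^sub>C x = r *\<^sub>R x"

class complex_inner = complex_vector + real_inner +
  fixes cinner :: "'a \<Rightarrow> 'a \<Rightarrow> complex"
  assumes cinner_commute: "cinner x y = cnj (cinner y x)"
    and cinner_add_left: "cinner (x + y) z = cinner x z + cinner y z"
    and cinner_scaleC_left: "cinner (a *\<^sub>C x) y = a * cinner x y"
    and inner_eq_Re_cinner: "inner x y = Re (cinner x y)"

class chilbert_space = complex_inner + complete_space

instantiation complex :: chilbert_space
begin

definition scaleC_complex :: "complex \<Rightarrow> complex \<Rightarrow> complex"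
  where "scaleC_complex a x = a * x"

definition cinner_complex :: "complex \<Rightarrow> complex \<Rightarrow> complex"
  where "cinner_complex x y = x * cnj y"

instance
  by standard
    (simp_all add: scaleC_complex_def cinner_complex_def inner_complex_def scaleR_conv_of_real
      algebra_simps)

end

definition bounded_clinear :: "('a::complex_inner \<Rightarrow> 'a) \<Rightarrow> bool"
  where "bounded_clinear T \<longleftrightarrow> bounded_linear T \<and> (\<forall>c x. T (c *\<^sub>C x) = c *\<^sub>C T x)"

definition cadjoint :: "('a::chilbert_space \<Rightarrow> 'a) \<Rightarrow> 'a \<Rightarrow> 'a"
  where "cadjoint T =
    (THE S. bounded_clinear S \<and> (\<forall>x y. cinner (T x) y = cinner x (S y)))"

definition positive_op :: "('a::chilbert_space \<Rightarrow> 'a) \<Rightarrow> bool"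
  where "positive_op A \<longleftrightarrow> bounded_clinear A \<and> (\<forall>x. cinner (A x) x \<in> \<real>\<^sub>\<ge>\<^sub>0)"

definition A_inner :: "('a::chilbert_space \<Rightarrow> 'a) \<Rightarrow> 'a \<Rightarrow> 'a \<Rightarrow> complex"
  where "A_inner A x y = cinner (A x) y"

text \<open>For positive \<open>A\<close> the number under the root is real, so \<open>Re\<close> is only a coercion.\<close>

definition A_norm :: "('a::chilbert_space \<Rightarrow> 'a) \<Rightarrow> 'a \<Rightarrow> real"
  where "A_norm A x = sqrt (Re (A_inner A x x))"

definition B_A :: "('a::chilbert_space \<Rightarrow> 'a) \<Rightarrow> ('a \<Rightarrow> 'a) set"
  where "B_A A = {T. bounded_clinear T \<and> range (cadjoint T \<circ> A) \<subseteq> range A}"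

definition A_adjoint :: "('a::chilbert_space \<Rightarrow> 'a) \<Rightarrow> ('a \<Rightarrow> 'a) \<Rightarrow> 'a \<Rightarrow> 'a"
  where "A_adjoint A T =
    (THE X. bounded_clinear X \<and> A \<circ> X = cadjoint T \<circ> A \<and> range X \<subseteq> closure (range A))"

definition A_Re :: "('a::chilbert_space \<Rightarrow> 'a) \<Rightarrow> ('a \<Rightarrow> 'a) \<Rightarrow> 'a \<Rightarrow> 'a"
  where "A_Re A T = (\<lambda>x. (1 / 2) *\<^sub>C (T x + A_adjoint A T x))"

text \<open>
  The suprema below are taken in \<open>real\<close>. The first two range over a nonempty set when \<open>A\<close> is
  positive and nonzero, and that set is bounded above when \<open>T\<close> is bounded with respect to
  \<open>A_norm A\<close>, which holds for every member of \<open>B_A A\<close>.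
\<close>

definition A_numerical_radius :: "('a::chilbert_space \<Rightarrow> 'a) \<Rightarrow> ('a \<Rightarrow> 'a) \<Rightarrow> real"
  where "A_numerical_radius A T = (SUP x\<in>{x. A_norm A x = 1}. cmod (A_inner A (T x) x))"

definition A_alpha_norm :: "('a::chilbert_space \<Rightarrow> 'a) \<Rightarrow> real \<Rightarrow> ('a \<Rightarrow> 'a) \<Rightarrow> real"
  where "A_alpha_norm A \<alpha> T =
    (SUP x\<in>{x. A_norm A x = 1}.
      sqrt (\<alpha> * (cmod (A_inner A (T x) x))\<^sup>2 + (1 - \<alpha>) * (A_norm A (T x))\<^sup>2))"

definition A_alpha_numerical_radius ::
    "('a::chilbert_space \<Rightarrow> 'a) \<Rightarrow> real \<Rightarrow> ('a \<Rightarrow> 'a) \<Rightarrow> real"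
  where "A_alpha_numerical_radius A \<alpha> T =
    (SUP \<theta>::real. A_alpha_norm A \<alpha> (A_Re A (\<lambda>x. exp (\<i> * complex_of_real \<theta>) *\<^sub>C T x)))"

end

theory Submission imports Defs begin

text \<open>
  For a fixed \<open>\<theta>\<close> write \<open>S\<close> for the A-real part of \<open>e\<^sup>i\<^sup>\<theta> T\<close>. It is selfadjoint for the semi-inner
  product of \<open>A\<close>, and the value of its form at \<open>x\<close> is the real part of \<open>e\<^sup>i\<^sup>\<theta> \<langle>T x, x\<rangle>\<^sub>A\<close>. Two classical
  facts then give the theorem. On A-unit vectors, the quantity under the \<open>\<alpha>\<close>-norm is a convex
  combination of the squares of \<open>\<bar>\<langle>S x, x\<rangle>\<^sub>A\<bar>\<close> and \<open>\<parallel>S x\<parallel>\<^sub>A\<close>, of which the first is the smaller by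
  the Cauchy-Schwarz inequality (\<open>A_cauchy_schwarz\<close>). For an A-selfadjoint operator the second is in
  turn at most any bound on the numerical range, by polarization (\<open>A_selfadjoint_norm_le\<close>). So for
  every \<open>\<alpha>\<close> the \<open>\<alpha>\<close>-norm of \<open>S\<close> is the supremum of \<open>\<bar>Re (e\<^sup>i\<^sup>\<theta> \<langle>T x, x\<rangle>\<^sub>A)\<bar>\<close>. It never exceeds the
  A-numerical radius of \<open>T\<close>, and letting \<open>\<theta>\<close> rotate \<open>\<langle>T x, x\<rangle>\<^sub>A\<close> onto the positive axis shows that the
  supremum over \<open>\<theta>\<close> is no smaller.

  Most of the work is to show that the objects in this argument exist. The adjoint comes from the
  projection theorem and the Riesz representation (\<open>adjoint_exists\<close>). The A-adjoint is an instance
  of Douglas' theorem (\<open>A_adjoint_exists\<close>): solving \<open>A m = T\<^sup>* (A x)\<close> with \<open>m\<close> in the closure of the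
  range of \<open>A\<close> defines a linear map, and the principle of uniform boundedness shows that it is
  bounded. Finally, the suprema are suprema of bounded sets because every operator with an
  A-adjoint is A-bounded (\<open>A_bounded\<close>). With \<open>S\<close> now the A-selfadjoint operator
  \<open>T\<^sup>\<sharp> T\<close>, where \<open>T\<^sup>\<sharp>\<close> is the A-adjoint of \<open>T\<close>, one has \<open>\<parallel>T x\<parallel>\<^sub>A\<^sup>2 = \<langle>S x, x\<rangle>\<^sub>A\<close>, and \<open>S\<close> is A-bounded because the
  sequence \<open>\<parallel>S\<^sup>k x\<parallel>\<^sub>A\<close> is log-convex and grows at most geometrically.
\<close>

section \<open>Two inequalities for real numbers\<close>

text \<open>
  The expression is the square root of a convex combination of \<open>a\<^sup>2\<close> and \<open>b\<^sup>2\<close>. With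
  \<open>a = \<bar>\<langle>S x, x\<rangle>\<^sub>A\<bar>\<close> and \<open>b = \<parallel>S x\<parallel>\<^sub>A\<close> both bounds have the same supremum over the
  A-unit vectors when \<open>S\<close> is A-selfadjoint, so \<open>\<alpha>\<close> drops out.
\<close>

lemma convex_combination_sqrt_bounds:
  fixes a b :: real
  assumes "\<alpha> \<in> {0..1}" and "0 \<le> a" and "a \<le> b"
  shows "a \<le> sqrt (\<alpha> * a\<^sup>2 + (1 - \<alpha>) * b\<^sup>2)" and "sqrt (\<alpha> * a\<^sup>2 + (1 - \<alpha>) * b\<^sup>2) \<le> b"
proof -
  have ab: "a\<^sup>2 \<le> b\<^sup>2" using assms by (simp add: power_mono)
  have "(1 - \<alpha>) * a\<^sup>2 \<le> (1 - \<alpha>) * b\<^sup>2" "\<alpha> * a\<^sup>2 \<le> \<alpha> * b\<^sup>2"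
    using assms(1) ab by (simp_all add: mult_left_mono)
  then have lo: "a\<^sup>2 \<le> \<alpha> * a\<^sup>2 + (1 - \<alpha>) * b\<^sup>2" and hi: "\<alpha> * a\<^sup>2 + (1 - \<alpha>) * b\<^sup>2 \<le> b\<^sup>2"
    by (simp_all add: algebra_simps)
  show "a \<le> sqrt (\<alpha> * a\<^sup>2 + (1 - \<alpha>) * b\<^sup>2)" using lo by (rule real_le_rsqrt)
  show "sqrt (\<alpha> * a\<^sup>2 + (1 - \<alpha>) * b\<^sup>2) \<le> b"
    using hi assms by (intro real_le_lsqrt) auto
qed

text \<open>
  Log-convexity makes the quotients \<open>u (k + 1) / u k\<close> nondecreasing, so \<open>u k\<close> is at least \<open>(u 1)\<^sup>k\<close>;
  if \<open>u 1\<close> exceeded \<open>M\<close>, this would outgrow \<open>C M\<^sup>k\<close>.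
\<close>

lemma log_convex_growth:
  fixes u :: "nat \<Rightarrow> real"
  assumes nonneg: "\<And>k. 0 \<le> u k" and "u 0 = 1"
    and convex: "\<And>k. (u (Suc k))\<^sup>2 \<le> u (Suc (Suc k)) * u k"
    and bound: "\<And>k. u k \<le> C * M ^ k" and "0 < M"
  shows "u 1 \<le> M"
proof (rule ccontr)
  assume "\<not> u 1 \<le> M"
  then have gt: "M < u 1" by simp
  then have u1: "0 < u 1" using \<open>0 < M\<close> by linarith
  have step: "0 < u k \<and> u 1 * u k \<le> u (Suc k)" for k
  proof (induction k)
    case 0
    then show ?case using \<open>u 0 = 1\<close> by simp
  next
    case (Suc k)
    then have pos: "0 < u (Suc k)" using u1 by (meson mult_pos_pos order_less_le_trans)
    have "(u 1 * u (Suc k)) * u k \<le> u (Suc k) * u (Suc k)"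
      using mult_left_mono[of "u 1 * u k" "u (Suc k)" "u (Suc k)"] Suc pos
      by (simp add: mult_ac)
    also have "\<dots> \<le> u (Suc (Suc k)) * u k" using convex[of k] by (simp add: power2_eq_square)
    finally have "u 1 * u (Suc k) \<le> u (Suc (Suc k))" using Suc by simp
    then show ?case using pos by simp
  qed
  have low: "u 1 ^ k \<le> u k" for k
  proof (induction k)
    case (Suc k)
    have "u 1 ^ Suc k \<le> u 1 * u k" using Suc u1 by simp
    then show ?case using step[of k] by linarith
  qed (use \<open>u 0 = 1\<close> in simp)
  have "1 < u 1 / M" using gt \<open>0 < M\<close> by simp
  then obtain k where "C < (u 1 / M) ^ k" using real_arch_pow by blast
  then have "C * M ^ k < u 1 ^ k" using \<open>0 < M\<close> by (simp add: power_divide field_simps)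
  then show False using low[of k] bound[of k] by linarith
qed

section \<open>Real Hilbert spaces\<close>

text \<open>
  The parallelogram law makes a sequence that minimizes the distance to \<open>x\<close> a Cauchy sequence,
  and completeness provides a closest point \<open>m\<close>. If \<open>x - m\<close> had a component along some
  \<open>y\<close> in \<open>M\<close>, moving \<open>m\<close> along \<open>y\<close> would bring it closer to \<open>x\<close>.
\<close>

lemma orthogonal_projection_exists:
  fixes M :: "'a::{real_inner,complete_space} set"
  assumes "closed M" and "subspace M"
  shows "\<exists>m\<in>M. \<forall>y\<in>M. inner (x - m) y = 0"
proof -
  define d where "d = (INF y\<in>M. norm (x - y))"
  have M0: "M \<noteq> {}" using subspace_0[OF assms(2)] by auto
  have bdd: "bdd_below ((\<lambda>y. norm (x - y)) ` M)"
    by (rule bdd_belowI2[of _ 0]) simp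
  have d_le: "d \<le> norm (x - y)" if "y \<in> M" for y
    unfolding d_def using bdd that by (rule cINF_lower)
  have d0: "0 \<le> d"
    unfolding d_def using M0 by (rule cINF_greatest) simp
  have "\<exists>y\<in>M. norm (x - y) < d + 1 / real (Suc n)" for n
  proof -
    have "(INF y\<in>M. norm (x - y)) < d + 1 / real (Suc n)"
      unfolding d_def by simp
    then show ?thesis using cINF_less_iff[OF M0 bdd] by blast
  qed
  then obtain f where fM: "\<And>n. f n \<in> M" and f: "\<And>n. norm (x - f n) < d + 1 / real (Suc n)"
    by metis
  have near: "(norm (f m - f n))\<^sup>2 \<le> (8 * d + 4) / real (Suc N)" if "N \<le> m" "N \<le> n" for m n N
  proof -
    let ?e = "1 / real (Suc N)"
    have e: "0 < ?e" "?e \<le> 1" by auto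
    have bound: "(norm (x - f k))\<^sup>2 \<le> d\<^sup>2 + (2 * d + 1) * ?e" if "N \<le> k" for k
    proof -
      have "1 / real (Suc k) \<le> ?e" using that by (simp add: frac_le)
      then have "norm (x - f k) \<le> d + ?e" using f[of k] by linarith
      then have "(norm (x - f k))\<^sup>2 \<le> (d + ?e)\<^sup>2" by (simp add: power_mono)
      also have "\<dots> = d\<^sup>2 + (2 * d + ?e) * ?e" by (simp add: power2_eq_square algebra_simps)
      also have "\<dots> \<le> d\<^sup>2 + (2 * d + 1) * ?e"
        using mult_right_mono[of "2 * d + ?e" "2 * d + 1" ?e] e by linarith
      finally show ?thesis .
    qed
    \<comment> \<open>The midpoint lies in \<open>M\<close>, so it is no closer to \<open>x\<close> than \<open>d\<close>.\<close>
    let ?h = "(1 / 2) *\<^sub>R (f m + f n)"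
    have "?h \<in> M"
      using assms(2) fM by (simp add: subspace_add subspace_scale)
    then have mid: "d\<^sup>2 \<le> (norm (x - ?h))\<^sup>2"
      using d_le d0 by (simp add: power_mono)
    have "(norm (f m - f n))\<^sup>2 = 2 * (norm (x - f m))\<^sup>2 + 2 * (norm (x - f n))\<^sup>2 - 4 * (norm (x - ?h))\<^sup>2"
      by (simp add: power2_norm_eq_inner inner_diff_left inner_diff_right inner_add_left
          inner_add_right inner_commute algebra_simps)
    also have "\<dots> \<le> 4 * (2 * d + 1) * ?e"
      using bound[OF that(1)] bound[OF that(2)] mid by linarith
    finally show ?thesis by simp
  qed
  have "Cauchy f"
  proof (rule CauchyI)
    fix e :: real assume e: "0 < e"
    obtain N where N: "(8 * d + 4) / e\<^sup>2 < real N" using reals_Archimedean2 by blast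
    have "(8 * d + 4) / e\<^sup>2 < real (Suc N)" using N by simp
    then have small: "(8 * d + 4) / real (Suc N) < e\<^sup>2"
      using e by (simp add: divide_less_eq mult.commute)
    have "norm (f m - f n) < e" if "N \<le> m" "N \<le> n" for m n
      using order_le_less_trans[OF near[OF that] small] e by (simp add: power_less_imp_less_base)
    then show "\<exists>M. \<forall>m\<ge>M. \<forall>n\<ge>M. norm (f m - f n) < e" by blast
  qed
  then obtain m where lim: "f \<longlonglongrightarrow> m" using Cauchy_convergent convergent_def by blast
  have mM: "m \<in> M" using closed_sequentially[OF assms(1) fM lim] .
  have "norm (x - m) \<le> d"
  proof (rule LIMSEQ_le)
    show "(\<lambda>n. norm (x - f n)) \<longlonglongrightarrow> norm (x - m)" by (intro tendsto_intros lim)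
    have "(\<lambda>n. d + 1 / real (Suc n)) \<longlonglongrightarrow> d + 0"
      by (intro tendsto_add tendsto_const LIMSEQ_Suc[OF lim_1_over_n])
    then show "(\<lambda>n. d + 1 / real (Suc n)) \<longlonglongrightarrow> d" by simp
    show "\<exists>N. \<forall>n\<ge>N. norm (x - f n) \<le> d + 1 / real (Suc n)" using f less_imp_le by blast
  qed
  then have closest: "norm (x - m) \<le> norm (x - y)" if "y \<in> M" for y
    using d_le[OF that] by linarith
  have "inner (x - m) y = 0" if y: "y \<in> M" for y
  proof (cases "y = 0")
    case False
    define c where "c = inner (x - m) y"
    \<comment> \<open>This \<open>t\<close> minimizes the quadratic \<open>\<parallel>x - m - t y\<parallel>\<^sup>2\<close>.\<close>
    define t where "t = c / inner y y"
    have yy: "inner y y > 0" using False by simp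
    have "m + t *\<^sub>R y \<in> M" using mM y assms(2) by (simp add: subspace_add subspace_scale)
    then have "(norm (x - m))\<^sup>2 \<le> (norm ((x - m) - t *\<^sub>R y))\<^sup>2"
      using closest[of "m + t *\<^sub>R y"] by (simp add: power_mono diff_diff_eq)
    also have "\<dots> = (norm (x - m))\<^sup>2 - 2 * t * c + t * t * inner y y"
      unfolding c_def
      by (simp add: power2_norm_eq_inner inner_diff_left inner_diff_right inner_commute
          algebra_simps)
    also have "\<dots> = (norm (x - m))\<^sup>2 - c\<^sup>2 / inner y y"
      unfolding t_def using yy by (simp add: field_simps power2_eq_square)
    finally have "c\<^sup>2 / inner y y \<le> 0" by simp
    then have "c\<^sup>2 \<le> 0" using yy by (simp add: divide_le_0_iff)
    then show ?thesis by (simp add: c_def)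
  qed simp
  then show ?thesis using mM by blast
qed

text \<open>
  The representing vector is a multiple of the part of some \<open>u\<close>, with \<open>f u \<noteq> 0\<close>, that is
  orthogonal to the kernel of \<open>f\<close>.
\<close>

lemma riesz_representation:
  fixes f :: "'a::{real_inner,complete_space} \<Rightarrow> real"
  assumes "bounded_linear f"
  shows "\<exists>y. \<forall>x. f x = inner x y"
proof (cases "\<forall>x. f x = 0")
  case True
  then show ?thesis by (intro exI[of _ 0]) simp
next
  case False
  interpret f: bounded_linear f by fact
  let ?M = "{x. f x = 0}"
  obtain u where u: "f u \<noteq> 0" using False by blast
  have "closed ?M"
    by (intro closed_Collect_eq continuous_intros f.continuous_on)
  moreover have "subspace ?M"
    by (auto simp: subspace_def f.add f.scale f.zero)
  ultimately obtain m where m: "f m = 0" and orth: "\<And>y. f y = 0 \<Longrightarrow> inner (u - m) y = 0"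
    using orthogonal_projection_exists[of ?M u] by auto
  let ?v = "u - m"
  have fv: "f ?v = f u" by (simp add: f.diff m)
  then have v: "inner ?v ?v \<noteq> 0" using u f.zero by force
  have "f x = inner x ((f u / inner ?v ?v) *\<^sub>R ?v)" for x
  proof -
    have "f (x - (f x / f u) *\<^sub>R ?v) = 0"
      using u by (simp add: f.diff f.scaleR m)
    from orth[OF this] have "inner ?v x = (f x / f u) * inner ?v ?v"
      by (simp add: inner_diff_right)
    then show ?thesis using u v by (simp add: inner_commute[of x])
  qed
  then show ?thesis by blast
qed

lemma adjoint_exists:
  fixes T :: "'a::{real_inner,complete_space} \<Rightarrow> 'a"
  assumes "bounded_linear T"
  shows "\<exists>S. bounded_linear S \<and> (\<forall>x y. inner (T x) y = inner x (S y))"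
proof -
  interpret T: bounded_linear T by fact
  have "\<exists>z. \<forall>x. inner (T x) y = inner x z" for y
    by (rule riesz_representation) (intro bounded_linear_intros assms)
  then obtain S where S: "\<And>x y. inner (T x) y = inner x (S y)" by metis
  have eqI: "a = b" if "\<And>x. inner x a = inner x b" for a b :: 'a
  proof -
    have "inner (a - b) (a - b) = 0" using that[of "a - b"] by (simp add: inner_diff_right)
    then show ?thesis by simp
  qed
  obtain K where K: "\<And>x. norm (T x) \<le> norm x * K" and K0: "0 \<le> K"
    using T.nonneg_bounded by blast
  have "bounded_linear S"
  proof (rule bounded_linear_intro)
    show "S (x + y) = S x + S y" for x y
      by (rule eqI) (simp add: inner_add_right flip: S)
    show "S (r *\<^sub>R x) = r *\<^sub>R S x" for r x
      by (rule eqI) (simp flip: S)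
    show "norm (S y) \<le> norm y * K" for y
    proof (cases "S y = 0")
      case False
      have "norm (S y) * norm (S y) = inner (T (S y)) y"
        by (simp add: S flip: power2_norm_eq_inner power2_eq_square)
      also have "\<dots> \<le> norm (T (S y)) * norm y" by (rule norm_cauchy_schwarz)
      also have "\<dots> \<le> (norm (S y) * K) * norm y" by (intro mult_right_mono K) simp
      finally show ?thesis using False by (simp add: mult.assoc mult.commute[of K])
    qed (simp add: K0)
  qed
  then show ?thesis using S by blast
qed

text \<open>
  The principle of uniform boundedness, for functionals represented by vectors. By Baire's theorem
  the bound on \<open>\<bar>inner x v\<bar>\<close> can be chosen uniform in \<open>v\<close> and in \<open>x\<close> from some ball, and a ball
  around any centre reaches in the direction of every \<open>v\<close>.
\<close>

lemma weakly_bounded_imp_bounded: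
  fixes V :: "'a::{real_inner,complete_space} set"
  assumes "\<And>x. \<exists>K. \<forall>v\<in>V. \<bar>inner x v\<bar> \<le> K"
  shows "\<exists>C\<ge>0. \<forall>v\<in>V. norm v \<le> C"
proof -
  define F where "F n = {x. \<forall>v\<in>V. \<bar>inner x v\<bar> \<le> real n}" for n
  have clo: "closed (F n)" for n
  proof -
    have "F n = (\<Inter>v\<in>V. {x. \<bar>inner x v\<bar> \<le> real n})" by (auto simp: F_def)
    then show ?thesis by (auto intro!: closed_INT closed_Collect_le continuous_intros)
  qed
  have "(\<Union>n. F n) = UNIV"
  proof -
    have "x \<in> (\<Union>n. F n)" for x
    proof -
      obtain K where K: "\<forall>v\<in>V. \<bar>inner x v\<bar> \<le> K" using assms by blast
      obtain n where "K \<le> real n" using real_arch_simple by blast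
      then have "x \<in> F n" using K by (force simp: F_def)
      then show ?thesis by blast
    qed
    then show ?thesis by blast
  qed
  moreover have "interior (\<Union>n. F n) = {}" if "\<And>n. interior (F n) = {}"
    using Met_TC.metric_Baire_category_alt[of "range F"] clo complete_UNIV[where 'a='a] that
    by auto
  ultimately obtain n x where "x \<in> interior (F n)" by auto
  then obtain r where r: "0 < r" and ball: "cball x r \<subseteq> F n"
    unfolding mem_interior_cball by blast
  have "norm v \<le> 2 * real n / r" if v: "v \<in> V" for v
  proof (cases "v = 0")
    case False
    let ?y = "x + (r / norm v) *\<^sub>R v"
    have "x \<in> F n" "?y \<in> F n"
      using ball r False by (auto simp: dist_norm subset_iff)
    then have "\<bar>inner x v\<bar> \<le> real n" "\<bar>inner ?y v\<bar> \<le> real n" using v by (auto simp: F_def)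
    then have "r / norm v * inner v v \<le> 2 * real n"
      by (auto simp: inner_add_left abs_le_iff)
    then have "r * norm v \<le> 2 * real n"
      using False by (simp add: power2_eq_square flip: power2_norm_eq_inner)
    then show ?thesis using r by (simp add: field_simps)
  qed (use r in simp)
  then show ?thesis using r by (intro exI[of _ "2 * real n / r"]) auto
qed

lemma subspace_closure:
  fixes S :: "'a::real_normed_vector set"
  assumes "subspace S"
  shows "subspace (closure S)"
proof (rule subspaceI)
  show "0 \<in> closure S" using subspace_0[OF assms] closure_subset by blast
  show "x + y \<in> closure S" if "x \<in> closure S" "y \<in> closure S" for x y
  proof -
    from that obtain f g where "\<And>n. f n \<in> S" "f \<longlonglongrightarrow> x" "\<And>n. g n \<in> S" "g \<longlonglongrightarrow> y"
      unfolding closure_sequential by blast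
    then show ?thesis unfolding closure_sequential
      by (intro exI[of _ "\<lambda>n. f n + g n"]) (auto intro: tendsto_add subspace_add assms)
  qed
  show "c *\<^sub>R x \<in> closure S" if "x \<in> closure S" for c x
  proof -
    from that obtain f where "\<And>n. f n \<in> S" "f \<longlonglongrightarrow> x"
      unfolding closure_sequential by blast
    then show ?thesis unfolding closure_sequential
      by (intro exI[of _ "\<lambda>n. c *\<^sub>R f n"]) (auto intro: tendsto_intros subspace_scale assms)
  qed
qed

section \<open>Complex Hilbert spaces\<close>

lemma cinner_scaleC_right:
  fixes x y :: "'a::complex_inner"
  shows "cinner x (c *\<^sub>C y) = cnj c * cinner x y"
  by (metis cinner_commute cinner_scaleC_left complex_cnj_mult)

lemma cinner_add_right:
  fixes x y z :: "'a::complex_inner"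
  shows "cinner x (y + z) = cinner x y + cinner x z"
  by (metis cinner_commute cinner_add_left complex_cnj_add)

lemma norm_scaleC:
  fixes x :: "'a::complex_inner"
  shows "norm (c *\<^sub>C x) = cmod c * norm x"
proof -
  have "cinner x x = complex_of_real ((norm x)\<^sup>2)"
    using arg_cong[OF cinner_commute[of x x], of Im]
    by (simp add: complex_eq_iff power2_norm_eq_inner inner_eq_Re_cinner del: cinner_commute)
  then have "(norm (c *\<^sub>C x))\<^sup>2 = Re (c * cnj c * complex_of_real ((norm x)\<^sup>2))"
    unfolding power2_norm_eq_inner inner_eq_Re_cinner
    by (simp add: cinner_scaleC_left cinner_scaleC_right mult_ac)
  also have "\<dots> = (cmod c * norm x)\<^sup>2"
    by (simp add: power_mult_distrib flip: complex_norm_square of_real_power of_real_mult)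
  finally show ?thesis by (simp add: power2_eq_iff_nonneg)
qed

lemma bounded_clinear_scaleC: "bounded_clinear (\<lambda>x::'a::complex_inner. c *\<^sub>C x)"
proof -
  have "c *\<^sub>C (r *\<^sub>R x) = r *\<^sub>R (c *\<^sub>C x)" for r and x :: 'a
    by (simp add: scaleC_scaleC mult.commute flip: scaleC_of_real)
  then have "bounded_linear (\<lambda>x::'a. c *\<^sub>C x)"
    by (intro bounded_linear_intro[of _ "cmod c"]) (simp_all add: scaleC_add_right norm_scaleC)
  then show ?thesis by (simp add: bounded_clinear_def scaleC_scaleC mult.commute)
qed

lemma bounded_clinear_compose:
  "bounded_clinear S \<Longrightarrow> bounded_clinear T \<Longrightarrow> bounded_clinear (\<lambda>x. S (T x))"
  by (auto simp: bounded_clinear_def intro: bounded_linear_compose)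

lemma cinner_right_eqI:
  fixes a b :: "'a::complex_inner"
  assumes "\<And>x. cinner x a = cinner x b"
  shows "a = b"
proof -
  have "inner (a - b) a = inner (a - b) b" by (simp add: assms inner_eq_Re_cinner)
  then have "inner (a - b) (a - b) = 0" by (simp add: inner_diff_right)
  then show ?thesis by simp
qed

text \<open>
  The imaginary part of \<open>cinner (T x) y\<close> is, up to sign, the real part of \<open>cinner (T (\<i> x)) y\<close>.
  Hence adjoints may be constructed and checked for the underlying real inner product.
\<close>

lemma cinner_adjoint_of_inner_adjoint:
  fixes S T :: "'a::complex_inner \<Rightarrow> 'a"
  assumes "\<And>c x. T (c *\<^sub>C x) = c *\<^sub>C T x" and inner: "\<And>x y. inner (T x) y = inner x (S y)"
  shows "cinner (T x) y = cinner x (S y)"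
proof -
  have "Im (cinner (T x) y) = - inner (T (\<i> *\<^sub>C x)) y"
    by (simp add: assms(1) inner_eq_Re_cinner cinner_scaleC_left)
  also have "\<dots> = Im (cinner x (S y))"
    by (simp add: inner) (simp add: inner_eq_Re_cinner cinner_scaleC_left)
  finally show ?thesis using inner by (simp add: complex_eq_iff inner_eq_Re_cinner)
qed

lemma cadjoint_eqI:
  assumes "bounded_clinear S" and "\<And>x y. cinner (T x) y = cinner x (S y)"
  shows "cadjoint T = S"
  unfolding cadjoint_def
proof (rule the_equality)
  fix S' assume "bounded_clinear S' \<and> (\<forall>x y. cinner (T x) y = cinner x (S' y))"
  then have S': "cinner x (S' y) = cinner (T x) y" for x y by simp
  show "S' = S"
    by (rule ext, rule cinner_right_eqI) (use S' in \<open>simp flip: assms(2)\<close>)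
qed (use assms in blast)

lemma cadjoint:
  assumes "bounded_clinear T"
  shows "bounded_clinear (cadjoint T)" and "cinner (T x) y = cinner x (cadjoint T y)"
proof -
  obtain S where S: "bounded_linear S" "\<And>x y. inner (T x) y = inner x (S y)"
    using adjoint_exists assms unfolding bounded_clinear_def by blast
  have adj: "cinner (T x) y = cinner x (S y)" for x y
    by (rule cinner_adjoint_of_inner_adjoint) (use assms S in \<open>auto simp: bounded_clinear_def\<close>)
  have "S (c *\<^sub>C y) = c *\<^sub>C S y" for c y
    by (rule cinner_right_eqI) (simp add: cinner_scaleC_right flip: adj)
  then have "bounded_clinear S" using S by (simp add: bounded_clinear_def)
  then have "cadjoint T = S" using adj by (rule cadjoint_eqI)
  then show "bounded_clinear (cadjoint T)" and "cinner (T x) y = cinner x (cadjoint T y)"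
    using \<open>bounded_clinear S\<close> adj by simp_all
qed

lemma cadjoint_scaleC:
  assumes "bounded_clinear T"
  shows "cadjoint (\<lambda>x. c *\<^sub>C T x) = (\<lambda>x. cnj c *\<^sub>C cadjoint T x)"
  by (rule cadjoint_eqI)
    (simp_all add: bounded_clinear_compose[OF bounded_clinear_scaleC] cadjoint[OF assms]
      cinner_scaleC_left cinner_scaleC_right)

lemma scaleC_mem_B_A:
  assumes A: "bounded_clinear A" and T: "T \<in> B_A A"
  shows "(\<lambda>x. c *\<^sub>C T x) \<in> B_A A"
proof -
  have Tc: "bounded_clinear T" and ran: "range (cadjoint T \<circ> A) \<subseteq> range A"
    using T by (auto simp: B_A_def)
  have "cadjoint (\<lambda>x. c *\<^sub>C T x) (A x) \<in> range A" for x
  proof -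
    have "cadjoint (\<lambda>x. c *\<^sub>C T x) (A x) = cadjoint T (A (cnj c *\<^sub>C x))"
      using A cadjoint(1)[OF Tc] by (simp add: cadjoint_scaleC[OF Tc] bounded_clinear_def)
    then show ?thesis using ran by auto
  qed
  then show ?thesis
    using bounded_clinear_compose[OF bounded_clinear_scaleC Tc] by (auto simp: B_A_def)
qed

section \<open>The semi-inner product of a positive operator\<close>

locale positive_operator =
  fixes A :: "'a::chilbert_space \<Rightarrow> 'a"
  assumes positive: "positive_op A"
begin

lemma bounded_clinear: "bounded_clinear A"
  using positive by (simp add: positive_op_def)

sublocale bounded_linear A
  using bounded_clinear by (simp add: bounded_clinear_def)

lemma scaleC: "A (c *\<^sub>C x) = c *\<^sub>C A x"
  using bounded_clinear by (simp add: bounded_clinear_def)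

text \<open>
  A form that is real on the diagonal is Hermitian: the vanishing of the imaginary part at \<open>x\<close>, \<open>y\<close>
  and \<open>x + \<i> y\<close> already gives symmetry for the real inner product.
\<close>

lemma inner_self_adjoint: "inner (A x) y = inner x (A y)"
proof -
  have im: "Im (cinner (A z) z) = 0" for z
    using positive by (simp add: positive_op_def complex_nonneg_Reals_iff)
  have "Im (cinner (A (x + \<i> *\<^sub>C y)) (x + \<i> *\<^sub>C y)) = 0" by (rule im)
  then have "Re (cinner (A x) y) = Re (cinner (A y) x)"
    by (simp add: add scaleC cinner_add_left cinner_add_right cinner_scaleC_left
        cinner_scaleC_right im)
  then show ?thesis by (simp add: inner_commute[of x] flip: inner_eq_Re_cinner)
qed

lemma A_inner_add_left: "A_inner A (x + y) z = A_inner A x z + A_inner A y z"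
  by (simp add: A_inner_def add cinner_add_left)

lemma A_inner_add_right: "A_inner A x (y + z) = A_inner A x y + A_inner A x z"
  by (simp add: A_inner_def cinner_add_right)

lemma A_inner_scaleC_left: "A_inner A (c *\<^sub>C x) y = c * A_inner A x y"
  by (simp add: A_inner_def scaleC cinner_scaleC_left)

lemma A_inner_scaleC_right: "A_inner A x (c *\<^sub>C y) = cnj c * A_inner A x y"
  by (simp add: A_inner_def cinner_scaleC_right)

lemmas A_inner_scaleR_left = A_inner_scaleC_left[of "complex_of_real r" for r, unfolded scaleC_of_real]
lemmas A_inner_scaleR_right =
  A_inner_scaleC_right[of _ "complex_of_real r" for r, unfolded scaleC_of_real complex_cnj_complex_of_real]

lemma A_inner_commute: "A_inner A x y = cnj (A_inner A y x)"
proof -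
  have "cinner (A x) y = cinner x (A y)"
    by (rule cinner_adjoint_of_inner_adjoint) (simp_all add: scaleC inner_self_adjoint)
  then show ?thesis by (metis A_inner_def cinner_commute)
qed

lemma A_inner_self: "A_inner A x x = complex_of_real ((A_norm A x)\<^sup>2)"
  using positive
  by (simp add: A_norm_def A_inner_def positive_op_def complex_nonneg_Reals_iff complex_eq_iff)

lemma A_norm_nonneg: "0 \<le> A_norm A x"
  by (metis A_inner_self A_norm_def Re_complex_of_real real_sqrt_ge_zero zero_le_power2)

lemma A_norm_scaleC: "A_norm A (c *\<^sub>C x) = cmod c * A_norm A x"
proof -
  have "complex_of_real ((A_norm A (c *\<^sub>C x))\<^sup>2) = (c * cnj c) * complex_of_real ((A_norm A x)\<^sup>2)"
    by (simp only: A_inner_scaleC_left A_inner_scaleC_right mult_ac flip: A_inner_self)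
  also have "\<dots> = complex_of_real ((cmod c * A_norm A x)\<^sup>2)"
    by (simp add: power_mult_distrib flip: complex_norm_square)
  finally have "(A_norm A (c *\<^sub>C x))\<^sup>2 = (cmod c * A_norm A x)\<^sup>2"
    by (simp only: of_real_eq_iff)
  then show ?thesis by (simp add: power2_eq_iff_nonneg A_norm_nonneg)
qed

lemma A_norm_add_sq:
  "(A_norm A (x + y))\<^sup>2 = (A_norm A x)\<^sup>2 + 2 * Re (A_inner A x y) + (A_norm A y)\<^sup>2"
proof -
  have "Re (A_inner A (x + y) (x + y)) = Re (A_inner A x x) + 2 * Re (A_inner A x y) + Re (A_inner A y y)"
    using arg_cong[OF A_inner_commute[of y x], of Re]
    by (simp add: A_inner_add_left A_inner_add_right)
  then show ?thesis by (simp add: A_inner_self)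
qed

lemma A_norm_scaleR: "A_norm A (r *\<^sub>R x) = \<bar>r\<bar> * A_norm A x"
  using A_norm_scaleC[of "complex_of_real r"] by (simp add: scaleC_of_real)

text \<open>
  The form may be degenerate, so the case \<open>\<parallel>x\<parallel>\<^sub>A = 0\<close> needs its own argument: there
  \<open>\<parallel>t x + y\<parallel>\<^sub>A\<^sup>2\<close> is affine in \<open>t\<close>, and being nowhere negative it must have slope zero. The complex inequality
  follows from the one for real parts by rotating \<open>x\<close>.
\<close>

lemma A_cauchy_schwarz: "cmod (A_inner A x y) \<le> A_norm A x * A_norm A y"
proof -
  have real_bound: "0 \<le> t\<^sup>2 * (A_norm A x)\<^sup>2 + 2 * t * Re (A_inner A x y) + (A_norm A y)\<^sup>2" for t x
    using A_norm_add_sq[of "t *\<^sub>R x" y] zero_le_power2[of "A_norm A (t *\<^sub>R x + y)"]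
    by (simp add: A_inner_scaleR_left A_norm_scaleR power_mult_distrib)
  have real_cs: "(Re (A_inner A x y))\<^sup>2 \<le> (A_norm A x)\<^sup>2 * (A_norm A y)\<^sup>2" for x
  proof (cases "A_norm A x = 0")
    case True
    have "Re (A_inner A x y) = 0"
    proof (rule ccontr)
      assume nz: "Re (A_inner A x y) \<noteq> 0"
      show False
        using real_bound[of "- ((A_norm A y)\<^sup>2 + 1) / (2 * Re (A_inner A x y))" x] nz True
        by (simp add: field_simps)
    qed
    then show ?thesis by simp
  next
    case False
    let ?n = "(A_norm A x)\<^sup>2" and ?r = "Re (A_inner A x y)"
    have n: "0 < ?n" using False by simp
    have "0 \<le> (- ?r / ?n)\<^sup>2 * ?n + 2 * (- ?r / ?n) * ?r + (A_norm A y)\<^sup>2" by (rule real_bound)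
    also have "\<dots> = (A_norm A y)\<^sup>2 - ?r\<^sup>2 / ?n"
      using n by (simp add: power2_eq_square)
    finally show ?thesis using n by (simp add: divide_le_eq mult.commute)
  qed
  obtain c where c: "cmod c = 1" "c * A_inner A x y = complex_of_real (cmod (A_inner A x y))"
  proof (cases "A_inner A x y = 0")
    case False
    then show ?thesis
      by (intro that[of "complex_of_real (cmod (A_inner A x y)) / A_inner A x y"])
         (simp_all add: norm_divide)
  qed (use that[of 1] in simp)
  have "(cmod (A_inner A x y))\<^sup>2 \<le> (A_norm A x * A_norm A y)\<^sup>2"
    using real_cs[of "c *\<^sub>C x"] c by (simp add: A_inner_scaleC_left A_norm_scaleC power_mult_distrib)
  then show ?thesis by (rule power2_le_imp_le) (simp add: A_norm_nonneg)
qed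

text \<open>
  This turns geometric growth of iterates in the Hilbert space norm into growth in the A-seminorm.
\<close>

lemma A_norm_le: "\<exists>C. \<forall>x. A_norm A x \<le> C * norm x"
proof -
  obtain K where K: "\<And>x. norm (A x) \<le> norm x * K" and K0: "0 \<le> K"
    using nonneg_bounded by blast
  have "A_norm A x \<le> sqrt K * norm x" for x
  proof -
    have "inner (A x) x \<le> norm (A x) * norm x" by (rule norm_cauchy_schwarz)
    also have "\<dots> \<le> (norm x * K) * norm x" by (intro mult_right_mono K) simp
    finally have "sqrt (inner (A x) x) \<le> sqrt (K * (norm x)\<^sup>2)"
      by (simp add: power2_eq_square mult_ac)
    then show ?thesis
      by (simp add: A_norm_def A_inner_def real_sqrt_mult flip: inner_eq_Re_cinner)
  qed
  then show ?thesis by blast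
qed

lemma A_norm_eq_1_exists:
  assumes "A \<noteq> (\<lambda>x. 0)"
  shows "\<exists>x. A_norm A x = 1"
proof -
  obtain x where x: "A x \<noteq> 0" using assms by blast
  have "A_norm A x \<noteq> 0"
  proof
    assume "A_norm A x = 0"
    then have "A_inner A x (A x) = 0" using A_cauchy_schwarz[of x "A x"] by simp
    then have "inner (A x) (A x) = 0" by (simp add: A_inner_def inner_eq_Re_cinner)
    then show False using x by simp
  qed
  then show ?thesis
    by (intro exI[of _ "(1 / A_norm A x) *\<^sub>R x"]) (simp add: A_norm_scaleR A_norm_nonneg)
qed

section \<open>Existence of the A-adjoint\<close>

text \<open>
  As \<open>A\<close> is selfadjoint, its kernel is the orthogonal complement of its range. This is what makes
  solutions of \<open>A m = v\<close> unique once \<open>m\<close> is confined to the closure of the range, and it lets any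
  solution be projected there.
\<close>

lemma kernel_orthogonal_closure_range:
  assumes "A d = 0" and "y \<in> closure (range A)"
  shows "inner d y = 0"
proof -
  have "closed {y. inner d y = 0}" by (intro closed_Collect_eq continuous_intros)
  moreover have "range A \<subseteq> {y. inner d y = 0}"
    using assms(1) by (auto simp flip: inner_self_adjoint)
  ultimately show ?thesis using closure_minimal assms(2) by blast
qed

lemma subspace_closure_range: "subspace (closure (range A))"
  by (intro subspace_closure linear_subspace_image linear_axioms subspace_UNIV)

lemma inj_on_closure_range: "inj_on A (closure (range A))"
proof (rule inj_onI)
  fix x y assume xy: "x \<in> closure (range A)" "y \<in> closure (range A)" "A x = A y"
  then have "inner (x - y) (x - y) = 0"
    by (intro kernel_orthogonal_closure_range) (simp_all add: diff subspace_diff subspace_closure_range)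
  then show "x = y" by simp
qed

lemma preimage_in_closure_range:
  "\<exists>m\<in>closure (range A). A m = A u"
proof -
  obtain m where m: "m \<in> closure (range A)" "\<And>y. y \<in> closure (range A) \<Longrightarrow> inner (u - m) y = 0"
    using orthogonal_projection_exists[OF closed_closure subspace_closure_range] by blast
  have "A (A (u - m)) \<in> closure (range A)"
    by (rule subsetD[OF closure_subset rangeI])
  from m(2)[OF this] have "inner (A (u - m)) (A (u - m)) = 0"
    by (simp add: inner_self_adjoint)
  then show ?thesis using m(1) by (auto simp: diff)
qed

lemma scaleC_closure_range:
  assumes "x \<in> closure (range A)"
  shows "c *\<^sub>C x \<in> closure (range A)"
proof -
  have "bounded_linear (\<lambda>x::'a. c *\<^sub>C x)"
    using bounded_clinear_scaleC by (auto simp: bounded_clinear_def)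
  then have "c *\<^sub>C x \<in> closure ((\<lambda>x. c *\<^sub>C x) ` range A)"
    using closure_bounded_linear_image_subset assms by blast
  also have "(\<lambda>x. c *\<^sub>C x) ` range A \<subseteq> range A" by (auto simp flip: scaleC)
  then have "closure ((\<lambda>x. c *\<^sub>C x) ` range A) \<subseteq> closure (range A)" by (rule closure_mono)
  finally show ?thesis .
qed

text \<open>
  Solving \<open>A (X x) = T\<^sup>* (A x)\<close> in the closure of the range of \<open>A\<close> determines a map \<open>X\<close>, which is linear
  by uniqueness. For the bound, \<open>\<langle>X x, A z\<rangle> = \<langle>x, A (T z)\<rangle>\<close>, so the vectors \<open>A (T z) / \<parallel>A z\<parallel>\<close> are weakly
  bounded, by \<open>\<parallel>X x\<parallel>\<close> at \<open>x\<close>. Uniform boundedness gives a norm bound \<open>C\<close> for them; it controls \<open>X x\<close>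
  tested against the range of \<open>A\<close>, hence against its closure, in which \<open>X x\<close> itself lies.
\<close>

lemma A_adjoint_exists:
  assumes "T \<in> B_A A"
  shows "\<exists>X. bounded_clinear X \<and> A \<circ> X = cadjoint T \<circ> A \<and> range X \<subseteq> closure (range A)"
proof -
  have Tc: "bounded_clinear T" and ran: "\<And>x. cadjoint T (A x) \<in> range A"
    using assms by (auto simp: B_A_def)
  note T' = cadjoint[OF Tc]
  have "\<exists>m\<in>closure (range A). A m = cadjoint T (A x)" for x
    using ran[of x] preimage_in_closure_range by (metis imageE)
  then obtain X where X: "\<And>x. X x \<in> closure (range A)" and AX: "\<And>x. A (X x) = cadjoint T (A x)"
    by metis
  have T'_lin: "cadjoint T (x + y) = cadjoint T x + cadjoint T y"
      "cadjoint T (c *\<^sub>C x) = c *\<^sub>C cadjoint T x" for x y c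
    using T'(1) by (simp_all add: bounded_clinear_def linear_add bounded_linear.linear)
  note eqI = inj_onD[OF inj_on_closure_range]
  have X_add: "X (x + y) = X x + X y" for x y
    by (rule eqI) (simp_all add: AX add T'_lin X subspace_add[OF subspace_closure_range])
  have X_scaleC: "X (c *\<^sub>C x) = c *\<^sub>C X x" for c x
    by (rule eqI) (simp_all add: AX scaleC T'_lin X scaleC_closure_range)
  have transfer: "inner (X x) (A z) = inner x (A (T z))" for x z
  proof -
    have "inner (X x) (A z) = inner (cadjoint T (A x)) z" by (simp add: AX flip: inner_self_adjoint)
    also have "\<dots> = inner z (cadjoint T (A x))" by (rule inner_commute)
    also have "\<dots> = inner (T z) (A x)" by (simp add: inner_eq_Re_cinner T'(2))
    finally show ?thesis by (simp add: inner_commute[of "T z"] inner_self_adjoint)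
  qed
  \<comment> \<open>If \<open>A z = 0\<close>, division by zero contributes the harmless vector \<open>0\<close>.\<close>
  define V where "V = range (\<lambda>z. (1 / norm (A z)) *\<^sub>R A (T z))"
  have "\<exists>K. \<forall>v\<in>V. \<bar>inner x v\<bar> \<le> K" for x
  proof (intro exI ballI)
    fix v assume "v \<in> V"
    then obtain z where "inner x v = inner (X x) (A z) / norm (A z)"
      by (auto simp: V_def transfer)
    moreover have "\<bar>inner (X x) (A z)\<bar> \<le> norm (X x) * norm (A z)" by (rule Cauchy_Schwarz_ineq2)
    ultimately show "\<bar>inner x v\<bar> \<le> norm (X x)"
      by (cases "A z = 0") (simp_all add: divide_le_eq)
  qed
  then obtain C where C: "\<And>v. v \<in> V \<Longrightarrow> norm v \<le> C" and C0: "0 \<le> C"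
    using weakly_bounded_imp_bounded by metis
  have bound: "inner (X x) y \<le> C * norm x * norm y" if "y \<in> closure (range A)" for x y
  proof -
    have "inner (X x) (A z) \<le> C * norm x * norm (A z)" for z
    proof (cases "A z = 0")
      case False
      have "inner (X x) (A z) / norm (A z) = inner x ((1 / norm (A z)) *\<^sub>R A (T z))"
        by (simp add: transfer)
      also have "\<dots> \<le> norm x * norm ((1 / norm (A z)) *\<^sub>R A (T z))" by (rule norm_cauchy_schwarz)
      also have "\<dots> \<le> norm x * C"
        by (intro mult_left_mono C) (auto simp: V_def)
      finally show ?thesis using False by (simp add: divide_le_eq mult_ac)
    qed simp
    then have "range A \<subseteq> {y. inner (X x) y \<le> C * norm x * norm y}" by auto
    moreover have "closed {y. inner (X x) y \<le> C * norm x * norm y}"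
      by (intro closed_Collect_le continuous_intros)
    ultimately show ?thesis using closure_minimal that by blast
  qed
  have "bounded_linear X"
  proof (rule bounded_linear_intro[OF X_add])
    show "X (r *\<^sub>R x) = r *\<^sub>R X x" for r x
      using X_scaleC[of "complex_of_real r"] by (simp add: scaleC_of_real)
    show "norm (X x) \<le> norm x * C" for x
    proof (cases "X x = 0")
      case False
      have "norm (X x) * norm (X x) \<le> C * norm x * norm (X x)"
        using bound[OF X, of x x] by (simp add: power2_norm_eq_inner flip: power2_eq_square)
      then show ?thesis using False by (simp add: mult.commute)
    qed (simp add: C0)
  qed
  then show ?thesis using X AX X_scaleC by (intro exI[of _ X]) (auto simp: bounded_clinear_def)
qed

lemma A_adjoint:
  assumes "T \<in> B_A A"
  shows "bounded_clinear (A_adjoint A T)"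
    and "A_inner A (A_adjoint A T x) y = A_inner A x (T y)"
proof -
  let ?P = "\<lambda>X. bounded_clinear X \<and> A \<circ> X = cadjoint T \<circ> A \<and> range X \<subseteq> closure (range A)"
  have "X = Y" if "?P X" "?P Y" for X Y
  proof
    fix x
    have "A (X x) = A (Y x)" using that by (metis comp_apply)
    then show "X x = Y x" using inj_onD[OF inj_on_closure_range] that by blast
  qed
  with A_adjoint_exists[OF assms] have "\<exists>!X. ?P X" by blast
  then have P: "?P (A_adjoint A T)" unfolding A_adjoint_def by (rule theI')
  then show "bounded_clinear (A_adjoint A T)" by blast
  have "bounded_clinear T" using assms by (simp add: B_A_def)
  then have "cinner (cadjoint T (A x)) y = cinner (A x) (T y)"
    by (metis cadjoint(2) cinner_commute)
  then show "A_inner A (A_adjoint A T x) y = A_inner A x (T y)"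
    using P by (simp add: A_inner_def) (metis comp_apply)
qed

section \<open>A-selfadjoint operators\<close>

text \<open>
  Selfadjointness turns \<open>\<parallel>S\<^sup>k\<^sup>+\<^sup>1 x\<parallel>\<^sub>A\<^sup>2\<close> into \<open>\<langle>S\<^sup>k\<^sup>+\<^sup>2 x, S\<^sup>k x\<rangle>\<^sub>A\<close>, so by the Cauchy-Schwarz inequality the
  sequence \<open>\<parallel>S\<^sup>k x\<parallel>\<^sub>A\<close> is log-convex, while boundedness of \<open>S\<close> in the Hilbert space norm limits it to
  geometric growth.
\<close>

lemma A_selfadjoint_bounded:
  assumes "bounded_linear S" and sa: "\<And>x y. A_inner A (S x) y = A_inner A x (S y)"
  shows "\<exists>K. \<forall>x. A_norm A x = 1 \<longrightarrow> A_norm A (S x) \<le> K"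
proof -
  obtain K where K: "0 < K" "\<And>x. norm (S x) \<le> norm x * K"
    using bounded_linear.pos_bounded[OF assms(1)] by blast
  obtain C where C: "\<And>x. A_norm A x \<le> C * norm x" using A_norm_le by blast
  have "A_norm A (S x) \<le> K" if x: "A_norm A x = 1" for x
  proof -
    have iter: "norm ((S ^^ k) x) \<le> norm x * K ^ k" for k
    proof (induction k)
      case (Suc k)
      have "norm (S ((S ^^ k) x)) \<le> norm ((S ^^ k) x) * K" by (rule K)
      also have "\<dots> \<le> (norm x * K ^ k) * K" using Suc K by (intro mult_right_mono) auto
      finally show ?case by (simp add: mult_ac)
    qed simp
    have C0: "0 \<le> C"
      using C[of x] x by (metis mult_nonpos_nonneg norm_ge_zero not_one_le_zero linorder_linear order_trans)
    have "A_norm A ((S ^^ 1) x) \<le> K"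
    proof (rule log_convex_growth)
      show "(A_norm A ((S ^^ Suc k) x))\<^sup>2 \<le> A_norm A ((S ^^ Suc (Suc k)) x) * A_norm A ((S ^^ k) x)" for k
      proof -
        let ?y = "(S ^^ k) x"
        have "complex_of_real ((A_norm A (S ?y))\<^sup>2) = A_inner A (S (S ?y)) ?y"
          unfolding sa[of "S ?y" ?y] by (rule A_inner_self[symmetric])
        then have "(A_norm A (S ?y))\<^sup>2 = cmod (A_inner A (S (S ?y)) ?y)"
          by (metis abs_of_nonneg norm_of_real zero_le_power2)
        also have "\<dots> \<le> A_norm A (S (S ?y)) * A_norm A ?y" by (rule A_cauchy_schwarz)
        finally show ?thesis by simp
      qed
      show "A_norm A ((S ^^ k) x) \<le> (C * norm x) * K ^ k" for k
        using C[of "(S ^^ k) x"] mult_left_mono[OF iter C0, of k] by (simp add: mult.assoc)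
    qed (use K x A_norm_nonneg in simp_all)
    then show ?thesis by simp
  qed
  then show ?thesis by blast
qed

text \<open>
  With \<open>T\<^sup>\<sharp>\<close> the A-adjoint of \<open>T\<close>, passing to the A-selfadjoint operator \<open>T\<^sup>\<sharp> T\<close> reduces this to the selfadjoint case, as
  \<open>\<parallel>T x\<parallel>\<^sub>A\<^sup>2 = \<langle>T\<^sup>\<sharp> T x, x\<rangle>\<^sub>A\<close>.
\<close>

lemma A_bounded:
  assumes "T \<in> B_A A"
  shows "\<exists>K. \<forall>x. A_norm A x = 1 \<longrightarrow> A_norm A (T x) \<le> K"
proof -
  let ?S = "\<lambda>x. A_adjoint A T (T x)"
  have flip: "A_inner A x (A_adjoint A T y) = A_inner A (T x) y" for x y
    by (metis A_adjoint(2)[OF assms] A_inner_commute)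
  have "bounded_linear ?S"
    using bounded_clinear_compose[OF A_adjoint(1)[OF assms]] assms
    by (auto simp: B_A_def bounded_clinear_def)
  then obtain K where K: "\<And>x. A_norm A x = 1 \<Longrightarrow> A_norm A (?S x) \<le> K"
    using A_selfadjoint_bounded[of ?S] A_adjoint(2)[OF assms] flip by auto
  have "A_norm A (T x) \<le> sqrt K" if x: "A_norm A x = 1" for x
  proof -
    have "complex_of_real ((A_norm A (T x))\<^sup>2) = A_inner A (?S x) x"
      unfolding A_adjoint(2)[OF assms] by (rule A_inner_self[symmetric])
    then have "(A_norm A (T x))\<^sup>2 = cmod (A_inner A (?S x) x)"
      by (metis abs_of_nonneg norm_of_real zero_le_power2)
    also have "\<dots> \<le> K" using A_cauchy_schwarz[of "?S x" x] K[OF x] x by simp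
    finally show ?thesis by (simp add: real_le_rsqrt)
  qed
  then show ?thesis by blast
qed

text \<open>
  Polarization with \<open>y = S x / \<parallel>S x\<parallel>\<^sub>A\<close> expresses \<open>4 \<parallel>S x\<parallel>\<^sub>A\<close> as the difference of the form of \<open>S\<close>
  at \<open>x + y\<close> and at \<open>x - y\<close>. These are bounded by \<open>w\<close> times the squared seminorms, which sum to \<open>4\<close> by
  the parallelogram law.
\<close>

lemma A_selfadjoint_norm_le:
  assumes "linear S" and sa: "\<And>x y. A_inner A (S x) y = A_inner A x (S y)"
    and w: "\<And>y. cmod (A_inner A (S y) y) \<le> w * (A_norm A y)\<^sup>2"
    and x: "A_norm A x = 1"
  shows "A_norm A (S x) \<le> w"
proof (cases "A_norm A (S x) = 0")
  case True
  then show ?thesis using order_trans[OF norm_ge_zero w[of x]] x by simp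
next
  case False
  let ?a = "A_norm A (S x)"
  have a: "0 < ?a" using False A_norm_nonneg[of "S x"] by linarith
  define y where "y = (1 / ?a) *\<^sub>R S x"
  have y: "A_norm A y = 1" using a by (simp add: y_def A_norm_scaleR)
  have Sxy: "A_inner A (S x) y = complex_of_real ?a"
    using a by (simp add: y_def A_inner_scaleR_right A_inner_self power2_eq_square)
  have Syx: "A_inner A (S y) x = complex_of_real ?a"
    using Sxy A_inner_commute[of y "S x"] by (simp add: sa)
  have neg: "A_inner A (- u) v = - A_inner A u v" "A_inner A u (- v) = - A_inner A u v" for u v
    using A_inner_scaleR_left[of "- 1" u v] A_inner_scaleR_right[of u "- 1" v] by simp_all
  have "A_inner A (S (x + y)) (x + y) - A_inner A (S (x + - y)) (x + - y)
      = 2 * (A_inner A (S x) y + A_inner A (S y) x)"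
    by (simp add: linear_add[OF assms(1)] linear_neg[OF assms(1)] A_inner_add_left
        A_inner_add_right neg del: add_uminus_conv_diff)
  from arg_cong[OF this, of Re]
  have "4 * ?a = Re (A_inner A (S (x + y)) (x + y)) - Re (A_inner A (S (x + - y)) (x + - y))"
    by (simp add: Sxy Syx)
  also have "\<dots> \<le> w * (A_norm A (x + y))\<^sup>2 + w * (A_norm A (x + - y))\<^sup>2"
    using w[of "x + y"] w[of "x + - y"] abs_Re_le_cmod[of "A_inner A (S (x + y)) (x + y)"]
      abs_Re_le_cmod[of "A_inner A (S (x + - y)) (x + - y)"] by linarith
  also have "\<dots> = w * 4"
    using A_norm_scaleR[of "- 1" y]
    by (simp only: A_norm_add_sq x y neg) (simp add: y algebra_simps)
  finally show ?thesis by simp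
qed

lemma A_Re:
  assumes "T \<in> B_A A"
  shows "bounded_linear (A_Re A T)"
    and "A_inner A (A_Re A T x) y = A_inner A x (A_Re A T y)"
    and "A_inner A (A_Re A T x) x = complex_of_real (Re (A_inner A (T x) x))"
proof -
  have flip: "A_inner A x (A_adjoint A T y) = A_inner A (T x) y" for x y
    by (metis A_adjoint(2)[OF assms] A_inner_commute)
  have "bounded_linear (\<lambda>x. T x + A_adjoint A T x)"
    using assms A_adjoint(1)[OF assms]
    by (intro bounded_linear_add) (auto simp: B_A_def bounded_clinear_def)
  moreover have "bounded_linear (\<lambda>x::'a. (1 / 2) *\<^sub>C x)"
    using bounded_clinear_scaleC by (auto simp: bounded_clinear_def)
  ultimately show "bounded_linear (A_Re A T)"
    unfolding A_Re_def using bounded_linear_compose by blast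
  show "A_inner A (A_Re A T x) y = A_inner A x (A_Re A T y)"
    by (simp add: A_Re_def A_inner_scaleC_left A_inner_scaleC_right A_inner_add_left
        A_inner_add_right A_adjoint(2)[OF assms] flip)
  have "A_inner A x (T x) = cnj (A_inner A (T x) x)" by (rule A_inner_commute)
  then show "A_inner A (A_Re A T x) x = complex_of_real (Re (A_inner A (T x) x))"
    by (simp add: A_Re_def A_inner_scaleC_left A_inner_add_left A_adjoint(2)[OF assms]
        complex_add_cnj)
qed

section \<open>The A-numerical radius\<close>

text \<open>
  The homogeneous form of the defining supremum also covers the vectors of A-seminorm zero, which
  cannot be normalized but on which the form vanishes.
\<close>

lemma A_numerical_radius_upper:
  assumes "T \<in> B_A A"
  shows "cmod (A_inner A (T x) x) \<le> A_numerical_radius A T * (A_norm A x)\<^sup>2"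
proof (cases "A_norm A x = 0")
  case True
  then show ?thesis using A_cauchy_schwarz[of "T x" x] by simp
next
  case False
  then have pos: "0 < A_norm A x" using A_norm_nonneg[of x] by linarith
  obtain K where K: "\<And>x. A_norm A x = 1 \<Longrightarrow> A_norm A (T x) \<le> K" using A_bounded[OF assms] by blast
  have bdd: "bdd_above ((\<lambda>x. cmod (A_inner A (T x) x)) ` {x. A_norm A x = 1})"
  proof (rule bdd_aboveI2)
    fix x assume "x \<in> {x. A_norm A x = 1}"
    then show "cmod (A_inner A (T x) x) \<le> K" using A_cauchy_schwarz[of "T x" x] K[of x] by simp
  qed
  let ?y = "(1 / A_norm A x) *\<^sub>R x"
  have "A_norm A ?y = 1" using pos by (simp add: A_norm_scaleR)
  then have "cmod (A_inner A (T ?y) ?y) \<le> A_numerical_radius A T"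
    unfolding A_numerical_radius_def by (intro cSUP_upper bdd) simp
  moreover have "linear T" using assms by (simp add: B_A_def bounded_clinear_def bounded_linear.linear)
  ultimately show ?thesis
    using pos
    by (simp add: linear_scale A_inner_scaleR_left A_inner_scaleR_right norm_mult norm_divide
        power2_eq_square field_simps)
qed

text \<open>
  The A-real part is A-selfadjoint, so its seminorm bound follows from one on its form; that form is
  the real part of a rotated value of the form of \<open>T\<close>, hence no larger in modulus.
\<close>

lemma A_norm_A_Re_le:
  assumes "T \<in> B_A A" and "A_norm A x = 1"
  shows "A_norm A (A_Re A (\<lambda>x. exp (\<i> * complex_of_real \<theta>) *\<^sub>C T x) x) \<le> A_numerical_radius A T"
proof -
  let ?U = "\<lambda>x. exp (\<i> * complex_of_real \<theta>) *\<^sub>C T x"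
  have U: "?U \<in> B_A A" by (rule scaleC_mem_B_A[OF bounded_clinear assms(1)])
  show ?thesis
  proof (rule A_selfadjoint_norm_le[OF bounded_linear.linear[OF A_Re(1)[OF U]] A_Re(2)[OF U] _ assms(2)])
    fix y
    have "cmod (A_inner A (A_Re A ?U y) y) \<le> cmod (A_inner A (?U y) y)"
      by (simp add: A_Re(3)[OF U] abs_Re_le_cmod)
    also have "\<dots> = cmod (A_inner A (T y) y)"
      by (simp add: A_inner_scaleC_left norm_mult)
    also have "\<dots> \<le> A_numerical_radius A T * (A_norm A y)\<^sup>2"
      by (rule A_numerical_radius_upper[OF assms(1)])
    finally show "cmod (A_inner A (A_Re A ?U y) y) \<le> A_numerical_radius A T * (A_norm A y)\<^sup>2" .
  qed
qed

end

theorem proposition4p1: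
  fixes A T :: "'a::chilbert_space \<Rightarrow> 'a" and \<alpha> :: real
  assumes "positive_op A" and "A \<noteq> (\<lambda>x. 0)"
    and "\<alpha> \<in> {0..1}"
    and "T \<in> B_A A"
  shows "A_alpha_numerical_radius A \<alpha> T = A_numerical_radius A T"
proof -
  interpret positive_operator A using assms(1) by unfold_locales
  note alpha = assms(3) and T = assms(4)
  let ?w = "A_numerical_radius A T"
  let ?unit = "{x. A_norm A x = 1}"
  let ?U = "\<lambda>\<theta> x. exp (\<i> * complex_of_real \<theta>) *\<^sub>C T x"
  let ?S = "\<lambda>\<theta>. A_Re A (?U \<theta>)"
  let ?g = "\<lambda>\<theta> x. sqrt (\<alpha> * (cmod (A_inner A (?S \<theta> x) x))\<^sup>2 + (1 - \<alpha>) * (A_norm A (?S \<theta> x))\<^sup>2)"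
  have U: "?U \<theta> \<in> B_A A" for \<theta> by (rule scaleC_mem_B_A[OF bounded_clinear T])
  have unit: "?unit \<noteq> {}" using A_norm_eq_1_exists[OF assms(2)] by blast
  have cs: "cmod (A_inner A (?S \<theta> x) x) \<le> A_norm A (?S \<theta> x)" if "x \<in> ?unit" for \<theta> x
    using A_cauchy_schwarz[of "?S \<theta> x" x] that by simp
  note g_bounds = convex_combination_sqrt_bounds[OF alpha norm_ge_zero cs]
  have g_le: "?g \<theta> x \<le> ?w" if "x \<in> ?unit" for \<theta> x
    using g_bounds(2)[OF that, of \<theta>] A_norm_A_Re_le[OF T, of x \<theta>] that by simp
  have norm_le: "A_alpha_norm A \<alpha> (?S \<theta>) \<le> ?w" for \<theta>
    unfolding A_alpha_norm_def using unit g_le by (rule cSUP_least)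
  have "A_alpha_numerical_radius A \<alpha> T \<le> ?w"
    unfolding A_alpha_numerical_radius_def using norm_le by (intro cSUP_least) auto
  moreover have "?w \<le> A_alpha_numerical_radius A \<alpha> T"
    unfolding A_numerical_radius_def
  proof (rule cSUP_least[OF unit])
    fix x assume x: "x \<in> ?unit"
    let ?z = "A_inner A (T x) x"
    \<comment> \<open>This angle rotates \<open>\<langle>T x, x\<rangle>\<^sub>A\<close> onto the nonnegative real axis.\<close>
    define \<theta> where "\<theta> = - Arg ?z"
    have "exp (\<i> * complex_of_real \<theta>) * ?z = complex_of_real (cmod ?z)"
    proof (cases "?z = 0")
      case False
      have "?z = complex_of_real (cmod ?z) * exp (\<i> * complex_of_real (Arg ?z))"
        using False by (rule Arg_eq)
      then have "exp (\<i> * complex_of_real \<theta>) * ?z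
          = complex_of_real (cmod ?z) * (exp (\<i> * complex_of_real \<theta>) * exp (\<i> * complex_of_real (Arg ?z)))"
        by (metis mult.left_commute)
      also have "exp (\<i> * complex_of_real \<theta>) * exp (\<i> * complex_of_real (Arg ?z)) = 1"
        by (simp add: \<theta>_def flip: exp_add)
      finally show ?thesis by simp
    qed simp
    then have "A_inner A (?S \<theta> x) x = complex_of_real (cmod ?z)"
      by (simp add: A_Re(3)[OF U] A_inner_scaleC_left)
    then have "cmod ?z \<le> ?g \<theta> x" using g_bounds(1)[OF x, of \<theta>] by simp
    also have "\<dots> \<le> A_alpha_norm A \<alpha> (?S \<theta>)"
      unfolding A_alpha_norm_def by (rule cSUP_upper[OF x bdd_aboveI2]) (rule g_le)
    also have "\<dots> \<le> A_alpha_numerical_radius A \<alpha> T"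
      unfolding A_alpha_numerical_radius_def by (rule cSUP_upper[OF UNIV_I bdd_aboveI2]) (rule norm_le)
    finally show "cmod ?z \<le> A_alpha_numerical_radius A \<alpha> T" .
  qed
  ultimately show ?thesis by (rule antisym)
qed

end
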